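(* The family $\{T_t\}_{t\in\mathbb{R}}$ is a strongly continuous one-parameter group of isometries in $\ell^2$, and its infinitesimal generator is $\pi H$.
   Context: $\ell^2$ is the Hilbert space of complex-valued sequences $\vec a=(a_j)_{j\in\mathbb{Z}}$ with $\|\vec a\|_{\ell^2}=(\sum_{j\in\mathbb{Z}}|a_j|^2)^{1/2}<\infty$. For $t\in\mathbb{R}$ the operator $T_t$ is defined (initially on finitely supported sequences, and by the same formula on $\ell^2$) by $$(T_t(\vec a))_m=\begin{cases}\displaystyle \frac{\sin(\pi t)}{\pi}\sum_{n\in\mathbb{Z}}\frac{a_n}{m-n+t} & \text{if } t\notin\mathbb{Z},\\[2mm] (-1)^t a_{m+t} & \text{if } t\in\mathbb{Z},\end{cases}\qquad m\in\mathbb{Z}.$$ The discrete Hilbert transform $H$ is the operator on $\ell^2$ given by $$(H(\vec a))_m=\frac1\pi\sum_{n\in\mathbb{Z},\, n\ne m}\frac{a_n}{m-n},\qquad m\in\mathbb{Z};$$ it is a well-known fact that $H$ is bounded on $\ell^2$. A one-parameter group of operators on a Banach space $X$ is a map $U$ from $\mathbb{R}$ to the bounded linear operators on $X$ such that $U(0)$ is the identity and $U(s)\circ U(t)=U(s+t)$ for all $s,t\in\mathbb{R}$. It is strongly continuous if $\lim_{t\to t_0}\|U(t)(x)-U(t_0)(x)\|=0$ for every $x\in X$ and every $t_0\in\mathbb{R}$. Its infinitesimal generator is the operator $A(x)=\lim_{h\to0^+}\frac{U(h)(x)-x}{h}$, whose domain $D(A)$ is the set of all $x\in X$ for which this limit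 exists in $X$. An isometry in $\ell^2$ is a linear operator $T$ with $\|T(\vec a)\|_{\ell^2}=\|\vec a\|_{\ell^2}$ for all $\vec a\in\ell^2$. *)

theory Defs
  imports "HOL-Analysis.Analysis"
begin

section \<open>Complex Banach spaces\<close>

text \<open>The class \<open>banach\<close> only provides real scalars; the scalar field of \<open>\<ell>\<^sup>2\<close> is complex.\<close>

class scaleC = scaleR +
  fixes scaleC :: "complex \<Rightarrow> 'a \<Rightarrow> 'a"  (infixr "*\<^sub>C" 75)

class complex_banach = banach + scaleC +
  assumes scaleC_add_right: "c *\<^sub>C (x + y) = c *\<^sub>C x + c *\<^sub>C y"
    and scaleC_add_left: "(c + d) *\<^sub>C x = c *\<^sub>C x + d *\<^sub>C x"
    and scaleC_scaleC: "c *\<^sub>C (d *\<^sub>C x) = (c * d) *\<^sub>C x"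
    and scaleC_of_real: "of_real r *\<^sub>C x = r *\<^sub>R x"
    and norm_scaleC: "norm (c *\<^sub>C x) = cmod c * norm x"

lemma scaleC_one: "1 *\<^sub>C x = (x :: 'a :: complex_banach)"
  using scaleC_of_real[of 1 x] by simp

lemma vector_space_scaleC:
  "vector_space (scaleC :: complex \<Rightarrow> 'a \<Rightarrow> 'a :: complex_banach)"
  by unfold_locales
    (simp_all add: scaleC_add_right scaleC_add_left scaleC_scaleC scaleC_one)

abbreviation clinear :: "('a::complex_banach \<Rightarrow> 'b::complex_banach) \<Rightarrow> bool" where
  "clinear \<equiv> Vector_Spaces.linear scaleC scaleC"

definition bounded_clinear :: "('a::complex_banach \<Rightarrow> 'b::complex_banach) \<Rightarrow> bool" where
  "bounded_clinear f \<longleftrightarrow> bounded_linear f \<and> clinear f"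

definition isometry :: "('a::complex_banach \<Rightarrow> 'b::complex_banach) \<Rightarrow> bool" where
  "isometry f \<longleftrightarrow> clinear f \<and> (\<forall>x. norm (f x) = norm x)"


section \<open>One-parameter groups of operators\<close>

definition one_parameter_group :: "(real \<Rightarrow> 'a::complex_banach \<Rightarrow> 'a) \<Rightarrow> bool" where
  "one_parameter_group U \<longleftrightarrow>
     (\<forall>t. bounded_clinear (U t)) \<and> U 0 = id \<and> (\<forall>s t. U s \<circ> U t = U (s + t))"

definition strongly_continuous :: "(real \<Rightarrow> 'a::complex_banach \<Rightarrow> 'a) \<Rightarrow> bool" where
  "strongly_continuous U \<longleftrightarrow>
     (\<forall>x t0. ((\<lambda>t. norm (U t x - U t0 x)) \<longlongrightarrow> 0) (at t0))"

definition generator_domain :: "(real \<Rightarrow> 'a::complex_banach \<Rightarrow> 'a) \<Rightarrow> 'a set" where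
  "generator_domain U =
     {x. \<exists>y. ((\<lambda>h. (U h x - x) /\<^sub>R h) \<longlongrightarrow> y) (at_right 0)}"

text \<open>Only meaningful on \<^term>\<open>generator_domain U\<close>.\<close>

definition generator :: "(real \<Rightarrow> 'a::complex_banach \<Rightarrow> 'a) \<Rightarrow> 'a \<Rightarrow> 'a" where
  "generator U x = Lim (at_right 0) (\<lambda>h. (U h x - x) /\<^sub>R h)"


section \<open>The Banach space of square-summable two-sided sequences\<close>

definition square_summable :: "(int \<Rightarrow> complex) set" where
  "square_summable = {a. (\<lambda>j. (cmod (a j))\<^sup>2) summable_on UNIV}"

definition l2norm :: "(int \<Rightarrow> complex) \<Rightarrow> real" where
  "l2norm a = sqrt (\<Sum>\<^sub>\<infinity>j. (cmod (a j))\<^sup>2)"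

lemma L2_set_le_l2norm:
  assumes "a \<in> square_summable" "finite F"
  shows "L2_set (\<lambda>j. cmod (a j)) F \<le> l2norm a"
  unfolding L2_set_def l2norm_def
  by (rule real_sqrt_le_mono, rule finite_sum_le_infsum)
    (use assms in \<open>auto simp: square_summable_def\<close>)

lemma square_summable_bound:
  assumes "\<And>F. finite F \<Longrightarrow> L2_set (\<lambda>j. cmod (a j)) F \<le> C"
  shows "a \<in> square_summable" "l2norm a \<le> C"
proof -
  have C: "0 \<le> C"
    using assms[of "{}"] by simp
  have le: "(\<Sum>j\<in>F. (cmod (a j))\<^sup>2) \<le> C\<^sup>2" if "finite F" for F
    using assms[OF that] C unfolding L2_set_def by (metis sqrt_le_D)
  show *: "a \<in> square_summable"
    unfolding square_summable_def mem_Collect_eq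
    by (rule nonneg_bdd_above_summable_on) (auto intro!: bdd_aboveI2 le)
  have "(\<Sum>\<^sub>\<infinity>j. (cmod (a j))\<^sup>2) \<le> C\<^sup>2"
    by (rule infsum_le_finite_sums) (use * le in \<open>auto simp: square_summable_def\<close>)
  then show "l2norm a \<le> C"
    using C by (simp add: l2norm_def real_le_lsqrt)
qed

lemma L2_set_add_le:
  assumes "a \<in> square_summable" "b \<in> square_summable" "finite F"
  shows "L2_set (\<lambda>j. cmod (a j + b j)) F \<le> l2norm a + l2norm b"
proof -
  have "L2_set (\<lambda>j. cmod (a j + b j)) F \<le> L2_set (\<lambda>j. cmod (a j) + cmod (b j)) F"
    by (rule L2_set_mono) (auto intro: norm_triangle_ineq)
  also have "\<dots> \<le> L2_set (\<lambda>j. cmod (a j)) F + L2_set (\<lambda>j. cmod (b j)) F"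
    by (rule L2_set_triangle_ineq)
  also have "\<dots> \<le> l2norm a + l2norm b"
    by (intro add_mono L2_set_le_l2norm assms)
  finally show ?thesis .
qed

lemmas square_summable_add = square_summable_bound(1)[OF L2_set_add_le]
lemmas l2norm_triangle = square_summable_bound(2)[OF L2_set_add_le]

lemma square_summable_scale:
  "a \<in> square_summable \<Longrightarrow> (\<lambda>j. c * a j) \<in> square_summable"
  unfolding square_summable_def mem_Collect_eq norm_mult power_mult_distrib
  by (rule summable_on_cmult_right)

lemma l2norm_scale: "l2norm (\<lambda>j. c * a j) = cmod c * l2norm a"
  by (simp add: l2norm_def norm_mult power_mult_distrib infsum_cmult_right' real_sqrt_mult)

lemma square_summable_zero: "(\<lambda>j. 0) \<in> square_summable"
  by (simp add: square_summable_def)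

typedef ell2 = square_summable
  morphisms seq_of ell2_of
  using square_summable_zero by blast

setup_lifting type_definition_ell2

instantiation ell2 :: real_normed_vector
begin

lift_definition zero_ell2 :: ell2 is "\<lambda>j. 0"
  by (rule square_summable_zero)

lift_definition plus_ell2 :: "ell2 \<Rightarrow> ell2 \<Rightarrow> ell2" is "\<lambda>a b j. a j + b j"
  by (rule square_summable_add)

lift_definition uminus_ell2 :: "ell2 \<Rightarrow> ell2" is "\<lambda>a j. - a j"
  by (simp add: square_summable_def)

lift_definition minus_ell2 :: "ell2 \<Rightarrow> ell2 \<Rightarrow> ell2" is "\<lambda>a b j. a j - b j"
proof -
  fix a b assume "a \<in> square_summable" "b \<in> square_summable"
  then show "(\<lambda>j. a j - b j) \<in> square_summable"
    using square_summable_add[OF _ square_summable_scale[of b "-1"], of a] by simp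
qed

lift_definition scaleR_ell2 :: "real \<Rightarrow> ell2 \<Rightarrow> ell2" is "\<lambda>r a j. of_real r * a j"
  by (rule square_summable_scale)

lift_definition norm_ell2 :: "ell2 \<Rightarrow> real" is l2norm .

definition "sgn_ell2 (x :: ell2) = inverse (norm x) *\<^sub>R x"
definition "dist_ell2 (x :: ell2) y = norm (x - y)"
definition [code del]:
  "(uniformity :: (ell2 \<times> ell2) filter) = (INF e\<in>{0 <..}. principal {(x, y). dist x y < e})"
definition [code del]:
  "open (U :: ell2 set) \<longleftrightarrow>
     (\<forall>x\<in>U. eventually (\<lambda>(x', y). x' = x \<longrightarrow> y \<in> U) uniformity)"

lemma norm_ell2_eq_0: "norm x = 0 \<longleftrightarrow> x = 0" for x :: ell2
proof transfer
  fix a :: "int \<Rightarrow> complex" assume a: "a \<in> square_summable"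
  show "l2norm a = 0 \<longleftrightarrow> a = (\<lambda>j. 0)"
  proof
    assume "l2norm a = 0"
    then have "cmod (a j) \<le> 0" for j
      using L2_set_le_l2norm[OF a, of "{j}"] by simp
    then show "a = (\<lambda>j. 0)" by auto
  qed (simp add: l2norm_def)
qed

instance
proof
  fix x y z :: ell2 and r s :: real
  show "x + y + z = x + (y + z)" by transfer (simp add: add.assoc)
  show "x + y = y + x" by transfer (simp add: add.commute)
  show "0 + x = x" by transfer simp
  show "- x + x = 0" by transfer simp
  show "x - y = x + - y" by transfer simp
  show "r *\<^sub>R (x + y) = r *\<^sub>R x + r *\<^sub>R y" by transfer (simp add: algebra_simps)
  show "(r + s) *\<^sub>R x = r *\<^sub>R x + s *\<^sub>R x" by transfer (simp add: algebra_simps)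
  show "r *\<^sub>R s *\<^sub>R x = (r * s) *\<^sub>R x" by transfer (simp add: mult.assoc)
  show "1 *\<^sub>R x = x" by transfer simp
  show "norm x = 0 \<longleftrightarrow> x = 0" by (rule norm_ell2_eq_0)
  show "norm (x + y) \<le> norm x + norm y" by transfer (rule l2norm_triangle)
  show "norm (r *\<^sub>R x) = \<bar>r\<bar> * norm x" by transfer (simp add: l2norm_scale)
  show "sgn x = inverse (norm x) *\<^sub>R x" by (rule sgn_ell2_def)
  show "dist x y = norm (x - y)" by (rule dist_ell2_def)
  show "(uniformity :: (ell2 \<times> ell2) filter) = (INF e\<in>{0 <..}. principal {(x, y). dist x y < e})"
    by (rule uniformity_ell2_def)
  show "open U \<longleftrightarrow> (\<forall>x\<in>U. eventually (\<lambda>(x', y). x' = x \<longrightarrow> y \<in> U) uniformity)" for U :: "ell2 set"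
    by (rule open_ell2_def)
qed

end

lemma ell2_complete:
  fixes X :: "nat \<Rightarrow> ell2"
  assumes X: "\<And>e. e > 0 \<Longrightarrow> \<exists>M. \<forall>m\<ge>M. \<forall>n\<ge>M. norm (X m - X n) < e"
  shows "\<exists>L. \<forall>e>0. \<exists>M. \<forall>n\<ge>M. norm (X n - L) \<le> e"
proof -
  have fin: "L2_set (\<lambda>j. cmod (seq_of x j)) F \<le> norm x" if "finite F" for x F
    using L2_set_le_l2norm[OF seq_of that] by (simp add: norm_ell2.rep_eq)
  have "Cauchy (\<lambda>n. seq_of (X n) j)" for j
  proof (rule CauchyI)
    fix e :: real assume "e > 0"
    from X[OF this] obtain M where M: "\<forall>m\<ge>M. \<forall>n\<ge>M. norm (X m - X n) < e" by blast
    have "cmod (seq_of (X m) j - seq_of (X n) j) \<le> norm (X m - X n)" for m n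
      using fin[of "{j}" "X m - X n"] by (simp add: minus_ell2.rep_eq)
    with M show "\<exists>M. \<forall>m\<ge>M. \<forall>n\<ge>M. norm (seq_of (X m) j - seq_of (X n) j) < e"
      by (meson le_less_trans)
  qed
  then have "\<exists>l. (\<lambda>n. seq_of (X n) j) \<longlonglongrightarrow> l" for j
    using Cauchy_convergent_iff convergent_def by blast
  then obtain l where l: "(\<lambda>n. seq_of (X n) j) \<longlonglongrightarrow> l j" for j
    by metis
  have bound: "(\<lambda>j. seq_of (X n) j - l j) \<in> square_summable \<and>
               l2norm (\<lambda>j. seq_of (X n) j - l j) \<le> e"
    if M: "\<forall>m\<ge>M. \<forall>n\<ge>M. norm (X m - X n) < e" and "n \<ge> M" for M n e
  proof -
    have "L2_set (\<lambda>j. cmod (seq_of (X n) j - l j)) F \<le> e" if F: "finite F" for F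
    proof (rule LIMSEQ_le_const2)
      show "(\<lambda>m. L2_set (\<lambda>j. cmod (seq_of (X n) j - seq_of (X m) j)) F)
              \<longlonglongrightarrow> L2_set (\<lambda>j. cmod (seq_of (X n) j - l j)) F"
        unfolding L2_set_def by (intro tendsto_intros l)
      have "L2_set (\<lambda>j. cmod (seq_of (X n) j - seq_of (X m) j)) F \<le> e" if "m \<ge> M" for m
      proof -
        have "norm (X n - X m) < e"
          using M that \<open>n \<ge> M\<close> by blast
        then show ?thesis
          using fin[OF F, of "X n - X m"] by (simp add: minus_ell2.rep_eq)
      qed
      then show "\<exists>N. \<forall>m\<ge>N. L2_set (\<lambda>j. cmod (seq_of (X n) j - seq_of (X m) j)) F \<le> e"
        by blast
    qed
    then show ?thesis
      using square_summable_bound[of "\<lambda>j. seq_of (X n) j - l j" e] by blast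
  qed
  obtain M where M: "\<forall>m\<ge>M. \<forall>n\<ge>M. norm (X m - X n) < 1"
    using X[of 1] by auto
  have d: "(\<lambda>j. seq_of (X M) j - l j) \<in> square_summable"
    using bound[OF M, of M] by simp
  have "seq_of (X M - ell2_of (\<lambda>j. seq_of (X M) j - l j)) = l"
    by (simp add: minus_ell2.rep_eq ell2_of_inverse[OF d])
  then obtain L where L: "seq_of L = l" by blast
  have "norm (X n - L) \<le> e"
    if "\<forall>m\<ge>M. \<forall>n\<ge>M. norm (X m - X n) < e" "n \<ge> M" for M n e
    using bound[OF that] by (simp add: norm_ell2.rep_eq minus_ell2.rep_eq L)
  with X show ?thesis by metis
qed

instance ell2 :: banach
proof
  fix X :: "nat \<Rightarrow> ell2"
  assume "Cauchy X"
  then obtain L where L: "\<forall>e>0. \<exists>M. \<forall>n\<ge>M. norm (X n - L) \<le> e"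
    using ell2_complete[of X] by (auto simp: Cauchy_iff)
  have "X \<longlonglongrightarrow> L"
  proof (rule LIMSEQ_I)
    fix e :: real assume "e > 0"
    then obtain M where "\<forall>n\<ge>M. norm (X n - L) \<le> e / 2"
      using L half_gt_zero by blast
    with \<open>e > 0\<close> have "\<forall>n\<ge>M. norm (X n - L) < e"
      by fastforce
    then show "\<exists>M. \<forall>n\<ge>M. norm (X n - L) < e" ..
  qed
  then show "convergent X" by (auto simp: convergent_def)
qed

instantiation ell2 :: complex_banach
begin

lift_definition scaleC_ell2 :: "complex \<Rightarrow> ell2 \<Rightarrow> ell2" is "\<lambda>c a j. c * a j"
  by (rule square_summable_scale)

instance
proof
  fix x y :: ell2 and r :: real and c d :: complex
  show "c *\<^sub>C (x + y) = c *\<^sub>C x + c *\<^sub>C y" by transfer (simp add: algebra_simps)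
  show "(c + d) *\<^sub>C x = c *\<^sub>C x + d *\<^sub>C x" by transfer (simp add: algebra_simps)
  show "c *\<^sub>C (d *\<^sub>C x) = (c * d) *\<^sub>C x" by transfer (simp add: mult.assoc)
  show "of_real r *\<^sub>C x = r *\<^sub>R x" by transfer simp
  show "norm (c *\<^sub>C x) = cmod c * norm x" by transfer (rule l2norm_scale)
qed

end

text \<open>
  The operator on \<^typ>\<open>ell2\<close> induced by a map of sequences. Since \<^const>\<open>ell2_of\<close> is
  unspecified outside \<^const>\<open>square_summable\<close>, this is only meaningful for maps that preserve
  \<^const>\<open>square_summable\<close>.
\<close>

definition ell2_op :: "((int \<Rightarrow> complex) \<Rightarrow> (int \<Rightarrow> complex)) \<Rightarrow> ell2 \<Rightarrow> ell2" where
  "ell2_op F x = ell2_of (F (seq_of x))"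


section \<open>The operators\<close>

text \<open>For square-summable \<open>a\<close> the sums below converge absolutely by Cauchy--Schwarz.\<close>

definition T_map :: "real \<Rightarrow> (int \<Rightarrow> complex) \<Rightarrow> (int \<Rightarrow> complex)" where
  "T_map t a m =
     (if t \<in> \<int> then (- 1) powi \<lfloor>t\<rfloor> * a (m + \<lfloor>t\<rfloor>)
      else of_real (sin (pi * t) / pi) *
             (\<Sum>\<^sub>\<infinity>n. a n / of_real (of_int m - of_int n + t)))"

definition H_map :: "(int \<Rightarrow> complex) \<Rightarrow> (int \<Rightarrow> complex)" where
  "H_map a m = of_real (1 / pi) * (\<Sum>\<^sub>\<infinity>n\<in>{n. n \<noteq> m}. a n / of_int (m - n))"

definition T_op :: "real \<Rightarrow> ell2 \<Rightarrow> ell2" where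
  "T_op t = ell2_op (T_map t)"

definition H_op :: "ell2 \<Rightarrow> ell2" where
  "H_op = ell2_op H_map"

end

theory Submission
  imports Defs "HOL-Real_Asymp.Real_Asymp"
begin

text \<open>
  For every real \<open>t\<close>, integral or not, $T_t$ is convolution with the kernel
  $k_t(j) = (-1)^j \mathrm{sinc}(t + j)$, where $\mathrm{sinc}(x) = \sin(\pi x)/(\pi x)$. All
  algebraic properties of the family come from the addition formula
  $\sum_n \mathrm{sinc}(x - n)\,\mathrm{sinc}(y + n) = \mathrm{sinc}(x + y)$ (\<open>sinc_convolution\<close>),
  which says $k_s * k_t = k_{s+t}$. Partial fractions reduce it to the bilateral sums
  $\sum_n 1/((y+n)(z+n))$ and $\sum_n 1/(y+n)^2$; these are differences and derivatives of the
  Digamma function, which the reflection formula of the Gamma function evaluates.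

  Since $k_{-t}(j) = k_t(-j)$, the case $s = -t$ says that the integer translates of $k_t$ are
  orthonormal. Hence $T_t$ is isometric on finitely supported sequences, and passing to the limit of
  finite sections it is a contraction of the whole space (\<open>conv_orthonormal\<close>). The group law
  holds on unit vectors by the addition formula and everywhere by continuity. A group of
  contractions consists of isometries, because the inverse operators are contractions as well.

  For $0 < |h| \le 1/2$ the kernel splits as
  $k_h = \sin(\pi h)\,\frac{1}{\pi j} + \frac{\sin(\pi h)}{\pi}\, e_h + \mathrm{sinc}(h)\,\delta_0$,
  where $|e_h(j)| = O(|h|/j^2)$ is absolutely summable with sum $O(|h|)$, so that convolution with
  $e_h$ has operator norm $O(|h|)$ by Young's inequality (\<open>conv_Young\<close>). At $h = 1/2$ this
  exhibits $H$ as a combination of bounded operators. As $h \to 0$ it shows that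
  $(T_h x - x)/h \to \pi H x$ for every \<open>x\<close> (\<open>T_op_derivative\<close>); this gives
  both the generator, with full domain, and strong continuity.
\<close>

section \<open>Bilateral sums from the reflection formula of the Gamma function\<close>

lemma sin_pi_mult_eq_0_iff: "sin (pi * x) = 0 \<longleftrightarrow> x \<in> \<int>"
  by (auto simp: sin_zero_iff_int2 elim!: Ints_cases)

lemma Gamma_reflection_real:
  fixes x :: real
  assumes "x \<notin> \<int>"
  shows "Gamma x * Gamma (1 - x) * sin (pi * x) = pi"
proof -
  have "sin (pi * x) \<noteq> 0"
    using assms by (simp add: sin_pi_mult_eq_0_iff)
  moreover have "Gamma x * Gamma (1 - x) = pi / sin (pi * x)"
  proof -
    have "complex_of_real (Gamma x * Gamma (1 - x)) = Gamma (of_real x) * Gamma (1 - of_real x)"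
      using Gamma_complex_of_real[of "1 - x"] by (simp add: Gamma_complex_of_real)
    also have "\<dots> = complex_of_real (pi / sin (pi * x))"
      using sin_of_real[of "pi * x", where 'a = complex] by (simp add: Gamma_reflection_complex)
    finally show ?thesis by (simp only: of_real_eq_iff)
  qed
  ultimately show ?thesis by simp
qed

text \<open>
  The complement of the integers is open, so an identity valid on it may be differentiated there.
\<close>

lemma derivative_0_if_const_off_Ints:
  fixes f :: "real \<Rightarrow> real"
  assumes "(f has_field_derivative d) (at x)" "x \<notin> \<int>" "\<And>y. y \<notin> \<int> \<Longrightarrow> f y = c"
  shows "d = 0"
proof -
  have "((\<lambda>_. c) has_field_derivative d) (at x)"
    by (rule has_field_derivative_transform_within_open[OF assms(1), of "- \<int>"])
      (use assms in auto)
  then show ?thesis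
    using DERIV_const DERIV_unique by blast
qed

lemma one_minus_notin_Ints: "x \<notin> \<int> \<Longrightarrow> 1 - x \<notin> \<int>" for x :: real
  by (metis Ints_1 Ints_diff add_diff_cancel_left' diff_add_cancel)

text \<open>
  The logarithmic derivative of $\Gamma(x)\Gamma(1-x)\sin(\pi x) = \pi$.
\<close>

lemma Digamma_reflection_real:
  fixes x :: real
  assumes x: "x \<notin> \<int>"
  shows "Digamma (1 - x) - Digamma x = pi * cot (pi * x)"
proof -
  have x': "1 - x \<notin> \<int>\<^sub>\<le>\<^sub>0" "x \<notin> \<int>\<^sub>\<le>\<^sub>0"
    using x one_minus_notin_Ints[OF x] nonpos_Ints_Int by blast+
  have "((\<lambda>x. Gamma (1 - x)) has_field_derivative Gamma (1 - x) * Digamma (1 - x) * - 1) (at x)"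
    by (rule DERIV_chain2[where f = Gamma and g = "\<lambda>x. 1 - x"])
      (use x' in \<open>auto intro!: has_field_derivative_Gamma derivative_eq_intros\<close>)
  moreover have "((\<lambda>x. sin (pi * x)) has_field_derivative cos (pi * x) * pi) (at x)"
    by (rule DERIV_chain2[where f = sin and g = "\<lambda>x. pi * x"]) (rule DERIV_sin DERIV_cmult_Id)+
  ultimately have "((\<lambda>x. Gamma x * Gamma (1 - x) * sin (pi * x)) has_field_derivative
          (Gamma x * Digamma x * Gamma (1 - x) + Gamma (1 - x) * Digamma (1 - x) * - 1 * Gamma x)
            * sin (pi * x) + cos (pi * x) * pi * (Gamma x * Gamma (1 - x))) (at x)"
    by (intro DERIV_mult has_field_derivative_Gamma x')
  also have "(Gamma x * Digamma x * Gamma (1 - x) + Gamma (1 - x) * Digamma (1 - x) * - 1 * Gamma x)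
            * sin (pi * x) + cos (pi * x) * pi * (Gamma x * Gamma (1 - x))
      = Gamma x * Gamma (1 - x) *
          (sin (pi * x) * (Digamma x - Digamma (1 - x)) + pi * cos (pi * x))"
    by (simp add: algebra_simps)
  finally have deriv: "((\<lambda>x. Gamma x * Gamma (1 - x) * sin (pi * x)) has_field_derivative \<dots>) (at x)" .
  from derivative_0_if_const_off_Ints[OF deriv x Gamma_reflection_real]
  have "sin (pi * x) * (Digamma x - Digamma (1 - x)) + pi * cos (pi * x) = 0"
    using x' by (auto simp: Gamma_eq_zero_iff)
  moreover have "e - d = c / s" if "s * (d - e) + c = 0" "s \<noteq> 0" for c d e s :: real
    using that by (simp add: eq_divide_eq algebra_simps)
  moreover have "sin (pi * x) \<noteq> 0"
    using x by (simp add: sin_pi_mult_eq_0_iff)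
  ultimately have "Digamma (1 - x) - Digamma x = pi * cos (pi * x) / sin (pi * x)"
    by blast
  then show ?thesis
    by (simp only: cot_def times_divide_eq_right)
qed

text \<open>
  The derivative of the reflection formula for Digamma.
\<close>

lemma Trigamma_reflection_real:
  fixes x :: real
  assumes x: "x \<notin> \<int>"
  shows "Polygamma 1 x + Polygamma 1 (1 - x) = (pi / sin (pi * x))\<^sup>2"
proof -
  have x': "1 - x \<notin> \<int>\<^sub>\<le>\<^sub>0" "x \<notin> \<int>\<^sub>\<le>\<^sub>0"
    using x one_minus_notin_Ints[OF x] nonpos_Ints_Int by blast+
  have s: "sin (pi * x) \<noteq> 0"
    using x by (simp add: sin_pi_mult_eq_0_iff)
  have "((\<lambda>x. cot (pi * x)) has_field_derivative - inverse ((sin (pi * x))\<^sup>2) * pi) (at x)"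
    by (rule DERIV_chain2[where f = cot and g = "\<lambda>x. pi * x"]) (rule DERIV_cot DERIV_cmult_Id s)+
  then have "((\<lambda>x. pi * cot (pi * x)) has_field_derivative pi * (- inverse ((sin (pi * x))\<^sup>2) * pi)) (at x)"
    by (rule DERIV_cmult)
  moreover have "((\<lambda>x. Digamma (1 - x)) has_field_derivative Polygamma 1 (1 - x) * - 1) (at x)"
    by (rule DERIV_chain2[where f = Digamma and g = "\<lambda>x. 1 - x"])
      (use has_field_derivative_Polygamma[OF x'(1), of 0 UNIV] in \<open>auto intro!: derivative_eq_intros\<close>)
  moreover have "(Digamma has_field_derivative Polygamma 1 x) (at x)"
    using has_field_derivative_Polygamma[OF x'(2), of 0 UNIV] by simp
  ultimately have "((\<lambda>x. Digamma (1 - x) - Digamma x - pi * cot (pi * x)) has_field_derivative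
          Polygamma 1 (1 - x) * - 1 - Polygamma 1 x - pi * (- inverse ((sin (pi * x))\<^sup>2) * pi)) (at x)"
    by (intro DERIV_diff)
  then have "Polygamma 1 (1 - x) * - 1 - Polygamma 1 x - pi * (- inverse ((sin (pi * x))\<^sup>2) * pi) = 0"
    by (rule derivative_0_if_const_off_Ints[OF _ x, of _ _ 0]) (simp add: Digamma_reflection_real)
  moreover have "p + q = (pi / s)\<^sup>2" if "q * - 1 - p - pi * (- inverse (s\<^sup>2) * pi) = 0" for p q s
    using that by (simp add: power_divide divide_inverse power2_eq_square algebra_simps)
  ultimately show ?thesis
    by blast
qed

text \<open>
  The negative integers are enumerated as $-1-k$: then $y + n$ becomes $-((1-y)+k)$, which turns the
  left half of a bilateral sum in $y$ into a one-sided sum in $1-y$, ready for a reflection formula.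
\<close>

lemma has_sum_int_split:
  fixes f :: "int \<Rightarrow> 'a :: real_normed_vector"
  assumes "((\<lambda>k::nat. f (int k)) has_sum a) UNIV" "((\<lambda>k::nat. f (- 1 - int k)) has_sum b) UNIV"
  shows "(f has_sum (a + b)) UNIV"
proof -
  have "(f has_sum a) (range int)"
    using assms(1) by (subst has_sum_reindex) (auto simp: o_def)
  moreover have "(f has_sum b) (range (\<lambda>k. - 1 - int k))"
    using assms(2) by (subst has_sum_reindex) (auto simp: o_def inj_def)
  moreover have "range int \<inter> range (\<lambda>k. - 1 - int k) = {}" by auto
  ultimately have "(f has_sum (a + b)) (range int \<union> range (\<lambda>k. - 1 - int k))"
    by (rule has_sum_Un_disjoint)
  moreover have "n \<in> range int \<union> range (\<lambda>k. - 1 - int k)" for n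
    by (cases "n \<ge> 0") (auto simp: image_iff intro: exI[of _ "nat n"] exI[of _ "nat (- 1 - n)"])
  then have "range int \<union> range (\<lambda>k. - 1 - int k) = UNIV" by blast
  ultimately show ?thesis by simp
qed

lemma Trigamma_has_sum:
  fixes y :: real
  assumes "y \<noteq> 0"
  shows "((\<lambda>k::nat. 1 / (y + of_nat k)\<^sup>2) has_sum Polygamma 1 y) UNIV"
proof -
  have "(\<lambda>k. 1 / (y + of_nat k)\<^sup>2) sums Polygamma 1 y"
    using Polygamma_LIMSEQ[of y 1] assms by (simp add: divide_inverse numeral_2_eq_2)
  then show ?thesis
    by (intro norm_summable_imp_has_sum) (auto simp: sums_iff)
qed

lemma abs_mult_le_sum_squares: "\<bar>u * v\<bar> \<le> u\<^sup>2 + v\<^sup>2" for u v :: real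
proof -
  have "2 * (\<bar>u\<bar> * \<bar>v\<bar>) \<le> u\<^sup>2 + v\<^sup>2"
    using sum_squares_bound[of "\<bar>u\<bar>" "\<bar>v\<bar>"] by (simp only: power2_abs mult.assoc)
  moreover have "0 \<le> \<bar>u\<bar> * \<bar>v\<bar>" by simp
  ultimately show ?thesis unfolding abs_mult by linarith
qed

text \<open>
  In the difference of the defining series of Digamma at \<open>z\<close> and \<open>y\<close> the harmonic
  terms cancel and partial fractions remain. The resulting series converges absolutely, so it
  can be summed in any order.
\<close>

lemma Digamma_diff_has_sum:
  fixes y z :: real
  assumes y: "y \<notin> \<int>" and z: "z \<notin> \<int>" and "y \<noteq> z"
  shows "((\<lambda>k::nat. 1 / ((y + of_nat k) * (z + of_nat k))) has_sum
           ((Digamma z - Digamma y) / (z - y))) UNIV"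
proof -
  have "w + of_nat k \<noteq> 0" if "w \<notin> \<int>" for w :: real and k
    using that by (auto simp: add_eq_0_iff2)
  then have nz: "y + of_nat k \<noteq> 0" "z + of_nat k \<noteq> 0" "y \<noteq> 0" "z \<noteq> 0" for k
    using y z by auto
  have D: "(\<lambda>k. inverse (of_nat (k+1)) - inverse (w + of_nat k)) sums (Digamma w + euler_mascheroni)"
    if "w \<noteq> 0" for w :: real
    using summable_sums[OF summable_Digamma[OF that]] by (simp add: Digamma_def)
  have "(\<lambda>k. ((inverse (of_nat (k+1)) - inverse (z + of_nat k))
           - (inverse (of_nat (k+1)) - inverse (y + of_nat k))) / (z - y)) sums
          ((Digamma z + euler_mascheroni - (Digamma y + euler_mascheroni)) / (z - y))"
    by (intro sums_divide sums_diff D nz)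
  moreover have "((inverse (of_nat (k+1)) - inverse (z + of_nat k))
           - (inverse (of_nat (k+1)) - inverse (y + of_nat k))) / (z - y)
        = 1 / ((y + of_nat k) * (z + of_nat k))" for k
  proof -
    have "(u - inverse q - (u - inverse p)) / (q - p) = 1 / (p * q)"
      if "p \<noteq> 0" "q \<noteq> 0" "q - p \<noteq> 0" for u p q :: real
      using that by (simp add: divide_simps) (simp add: algebra_simps)
    from this[OF nz(1,2)[of k]] show ?thesis
      using \<open>y \<noteq> z\<close> by simp
  qed
  ultimately have "(\<lambda>k. 1 / ((y + of_nat k) * (z + of_nat k))) sums ((Digamma z - Digamma y) / (z - y))"
    by simp
  moreover have "summable (\<lambda>k. norm (1 / ((y + of_nat k) * (z + of_nat k))))"
  proof (rule summable_comparison_test')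
    show "summable (\<lambda>k. 1 / (y + of_nat k)\<^sup>2 + 1 / (z + of_nat k)\<^sup>2)"
      using Trigamma_has_sum[OF nz(3)] Trigamma_has_sum[OF nz(4)]
      by (intro summable_add) (auto dest!: has_sum_imp_sums sums_summable)
    fix k :: nat
    show "norm (norm (1 / ((y + of_nat k) * (z + of_nat k)))) \<le> 1 / (y + of_nat k)\<^sup>2 + 1 / (z + of_nat k)\<^sup>2"
      using abs_mult_le_sum_squares[of "1 / (y + of_nat k)" "1 / (z + of_nat k)"]
      by (simp add: power_one_over)
  qed
  ultimately show ?thesis by (intro norm_summable_imp_has_sum)
qed

lemma inverse_square_bilateral_sum:
  fixes y :: real
  assumes y: "y \<notin> \<int>"
  shows "((\<lambda>n::int. 1 / (y + of_int n)\<^sup>2) has_sum (pi / sin (pi * y))\<^sup>2) UNIV"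
proof -
  have nz: "y \<noteq> 0" "1 - y \<noteq> 0" using y by auto
  have "(y + of_int (- 1 - int k))\<^sup>2 = ((1 - y) + of_nat k)\<^sup>2" for k
    by (simp add: power2_eq_square algebra_simps)
  then have "((\<lambda>n::int. 1 / (y + of_int n)\<^sup>2) has_sum (Polygamma 1 y + Polygamma 1 (1 - y))) UNIV"
    by (intro has_sum_int_split)
      (use Trigamma_has_sum[OF nz(1)] Trigamma_has_sum[OF nz(2)] in \<open>simp_all only: of_int_of_nat_eq\<close>)
  then show ?thesis
    by (simp only: Trigamma_reflection_real[OF y])
qed

lemma cot_diff_bilateral_sum:
  fixes y z :: real
  assumes y: "y \<notin> \<int>" and z: "z \<notin> \<int>" and "y \<noteq> z"
  shows "((\<lambda>n::int. 1 / ((y + of_int n) * (z + of_int n))) has_sum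
           (pi * (cot (pi * y) - cot (pi * z)) / (z - y))) UNIV"
proof -
  have eq: "(y + of_int (- 1 - int k)) * (z + of_int (- 1 - int k)) =
        ((1 - y) + of_nat k) * ((1 - z) + of_nat k)" for k
    by (simp add: algebra_simps)
  have "((\<lambda>n::int. 1 / ((y + of_int n) * (z + of_int n))) has_sum
           ((Digamma z - Digamma y) / (z - y)
             + (Digamma (1 - z) - Digamma (1 - y)) / ((1 - z) - (1 - y)))) UNIV"
    by (rule has_sum_int_split, unfold eq of_int_of_nat_eq; rule Digamma_diff_has_sum)
       (use assms one_minus_notin_Ints in auto)
  moreover have "(Digamma z - Digamma y) / (z - y)
       + (Digamma (1 - z) - Digamma (1 - y)) / ((1 - z) - (1 - y))
     = ((Digamma (1 - y) - Digamma y) - (Digamma (1 - z) - Digamma z)) / (z - y)"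
  proof -
    have "a / (z - y) + b / ((1 - z) - (1 - y)) = (a - b) / (z - y)" for a b
      by (simp add: diff_divide_distrib minus_divide_right)
    from this[of "Digamma z - Digamma y" "Digamma (1 - z) - Digamma (1 - y)"] show ?thesis
      by (simp only: diff_diff_eq2 add_diff_eq diff_add_eq add.commute add.left_commute)
  qed
  ultimately show ?thesis
    by (simp add: Digamma_reflection_real y z right_diff_distrib)
qed

section \<open>The addition formula of the cardinal sine\<close>

definition sinc :: "real \<Rightarrow> real" where
  "sinc x = (if x = 0 then 1 else sin (pi * x) / (pi * x))"

lemma sinc_minus: "sinc (- x) = sinc x"
  by (simp add: sinc_def)

lemma sinc_of_int: "sinc (of_int n) = (if n = 0 then 1 else 0)"
  by (simp add: sinc_def)

lemma sin_pi_add_int: "sin (pi * (x + of_int n)) = (- 1) powi n * sin (pi * x)"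
  by (cases "even n") (auto simp: distrib_left sin_add sin_npi_int cos_npi_int power_int_minus_left)

text \<open>
  If \<open>x\<close> or \<open>y\<close> is an integer, only one term is nonzero. Otherwise the factors
  $(-1)^n$ of the two sines cancel, and the sum is a constant multiple of a bilateral sum:
  that of inverse squares if $x + y = 0$, and one given by a difference of cotangents otherwise.
\<close>

theorem sinc_convolution:
  "((\<lambda>n::int. sinc (x - of_int n) * sinc (y + of_int n)) has_sum sinc (x + y)) UNIV"
proof -
  have int: "((\<lambda>n::int. sinc (x - of_int n) * sinc (y + of_int n)) has_sum sinc (x + y)) UNIV"
    if "x = of_int k" for x y k
  proof -
    have "((\<lambda>n::int. sinc (x - of_int n) * sinc (y + of_int n)) has_sum sinc (x + y)) {k}"
      using sinc_of_int[of 0] by (intro has_sum_finiteI) (auto simp: that add.commute)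
    moreover have "sinc (x - of_int n) = 0" if "n \<noteq> k" for n
      using sinc_of_int[of "k - n"] that \<open>x = of_int k\<close> by simp
    ultimately show ?thesis
      by (subst has_sum_cong_neutral[where T = "{k}"]) auto
  qed
  consider "x \<in> \<int>" | "y \<in> \<int>" | "x \<notin> \<int>" "y \<notin> \<int>" "x + y = 0" | "x \<notin> \<int>" "y \<notin> \<int>" "x + y \<noteq> 0"
    by blast
  then show ?thesis
  proof cases
    case 1
    then show ?thesis using int by (auto elim: Ints_cases)
  next
    case 2
    then obtain k where "y = of_int k" by (auto elim: Ints_cases)
    from int[OF this, of x]
    have "((\<lambda>n::int. sinc (y - of_int (- n)) * sinc (x + of_int (- n))) has_sum sinc (x + y)) UNIV"
      by (subst has_sum_reindex_bij_witness[of UNIV uminus uminus UNIV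
          "\<lambda>n. sinc (y - of_int n) * sinc (x + of_int n)"]) (auto simp: add.commute)
    then show ?thesis by (simp add: mult.commute)
  next
    case 3
    have "((\<lambda>n::int. (sin (pi * y) / pi)\<^sup>2 * (1 / (y + of_int n)\<^sup>2)) has_sum
            (sin (pi * y) / pi)\<^sup>2 * (pi / sin (pi * y))\<^sup>2) UNIV"
      by (intro has_sum_cmult_right inverse_square_bilateral_sum 3)
    moreover have "(sin (pi * y) / pi)\<^sup>2 * (pi / sin (pi * y))\<^sup>2 = 1"
      using 3 sin_pi_mult_eq_0_iff[of y] by (simp add: power_divide)
    moreover have "(sin (pi * y) / pi)\<^sup>2 * (1 / (y + of_int n)\<^sup>2)
        = sinc (x - of_int n) * sinc (y + of_int n)" for n
    proof -
      have x: "x - of_int n = - (y + of_int n)" using 3 by simp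
      have "y + of_int n \<noteq> 0"
        using 3(2) by (metis Ints_minus Ints_of_int add_eq_0_iff2)
      then show ?thesis unfolding x sinc_minus
        by (simp add: sinc_def sin_pi_add_int power2_eq_square power_int_minus_left)
    qed
    ultimately show ?thesis using 3 by (simp add: sinc_def)
  next
    case 4
    have x': "- x \<notin> \<int>" using 4 by simp
    let ?c = "- (sin (pi * x) * sin (pi * y) / pi\<^sup>2)"
    have "((\<lambda>n::int. ?c * (1 / ((y + of_int n) * (- x + of_int n)))) has_sum
            ?c * (pi * (cot (pi * y) - cot (pi * - x)) / (- x - y))) UNIV"
      using 4 by (intro has_sum_cmult_right cot_diff_bilateral_sum x') auto
    moreover have "?c * (pi * (cot (pi * y) - cot (pi * - x)) / (- x - y)) = sinc (x + y)"
    proof -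
      have nz: "sin (pi * x) \<noteq> 0" "sin (pi * y) \<noteq> 0"
        using 4 sin_pi_mult_eq_0_iff[of y] sin_pi_mult_eq_0_iff[of x] by auto
      have "sin (pi * x) * sin (pi * y) * (cot (pi * y) - cot (pi * - x)) = sin (pi * (x + y))"
        using nz by (simp add: cot_def field_simps sin_add)
      moreover have "?c * (pi * (cot (pi * y) - cot (pi * - x)) / (- x - y)) =
        sin (pi * x) * sin (pi * y) * (cot (pi * y) - cot (pi * - x)) / (pi * (x + y))"
        using 4 by (simp add: divide_simps power2_eq_square) (simp add: algebra_simps)
      ultimately show ?thesis using 4 by (simp add: sinc_def)
    qed
    moreover have "?c * (1 / ((y + of_int n) * (- x + of_int n)))
        = sinc (x - of_int n) * sinc (y + of_int n)" for n
    proof -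
      have nz: "y + of_int n \<noteq> 0" "- x + of_int n \<noteq> 0"
        using 4(2) x' by (metis Ints_minus Ints_of_int add_eq_0_iff2)+
      have "sinc (x - of_int n) = sinc (- x + of_int n)"
        using sinc_minus[of "x - of_int n"] by simp
      also have "\<dots> = (- 1) powi n * - sin (pi * x) / (pi * (- x + of_int n))"
        using nz(2) sin_pi_add_int[of "- x" n] unfolding sinc_def by simp
      finally have "sinc (x - of_int n) * sinc (y + of_int n) =
          (- 1) powi n * - sin (pi * x) / (pi * (- x + of_int n))
            * ((- 1) powi n * sin (pi * y) / (pi * (y + of_int n)))"
        using nz(1) by (simp add: sinc_def sin_pi_add_int)
      also have "\<dots> = ?c * (1 / ((y + of_int n) * (- x + of_int n)))"
        by (simp add: power2_eq_square power_int_minus_left mult_ac)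
      finally show ?thesis ..
    qed
    ultimately show ?thesis by simp
  qed
qed

section \<open>Convolution of two-sided sequences\<close>

definition conv :: "(int \<Rightarrow> real) \<Rightarrow> (int \<Rightarrow> complex) \<Rightarrow> (int \<Rightarrow> complex)" where
  "conv w a m = (\<Sum>\<^sub>\<infinity>n. of_real (w (m - n)) * a n)"

text \<open>
  A form of Fatou's lemma: the bound on finite sections in both variables survives pointwise
  limits in \<open>n\<close> along finite sets, since only finitely many coordinates \<open>m\<close> are involved at a time.
\<close>

lemma infsum_square_summable:
  fixes g :: "int \<Rightarrow> int \<Rightarrow> complex"
  assumes g: "\<And>m. g m summable_on UNIV"
    and bound: "\<And>A F. finite A \<Longrightarrow> finite F \<Longrightarrow> L2_set (\<lambda>m. cmod (\<Sum>n\<in>A. g m n)) F \<le> C"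
  shows "(\<lambda>m. \<Sum>\<^sub>\<infinity>n. g m n) \<in> square_summable" "l2norm (\<lambda>m. \<Sum>\<^sub>\<infinity>n. g m n) \<le> C"
proof -
  have lim: "((\<lambda>A. \<Sum>n\<in>A. g m n) \<longlongrightarrow> (\<Sum>\<^sub>\<infinity>n. g m n)) (finite_subsets_at_top UNIV)" for m
    using has_sum_infsum[OF g[of m]] by (simp add: has_sum_def)
  have "L2_set (\<lambda>m. cmod (\<Sum>\<^sub>\<infinity>n. g m n)) F \<le> C" if F: "finite F" for F
  proof (rule tendsto_upperbound)
    show "((\<lambda>A. L2_set (\<lambda>m. cmod (\<Sum>n\<in>A. g m n)) F) \<longlongrightarrow> L2_set (\<lambda>m. cmod (\<Sum>\<^sub>\<infinity>n. g m n)) F)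
            (finite_subsets_at_top UNIV)"
      unfolding L2_set_def by (intro tendsto_intros lim)
    show "\<forall>\<^sub>F A in finite_subsets_at_top UNIV. L2_set (\<lambda>m. cmod (\<Sum>n\<in>A. g m n)) F \<le> C"
      by (rule eventually_finite_subsets_at_top_weakI) (rule bound[OF _ F])
  qed simp
  then show "(\<lambda>m. \<Sum>\<^sub>\<infinity>n. g m n) \<in> square_summable" "l2norm (\<lambda>m. \<Sum>\<^sub>\<infinity>n. g m n) \<le> C"
    by (rule square_summable_bound; simp)+
qed

lemma square_summable_shift:
  assumes "a \<in> square_summable"
  shows "(\<lambda>m. a (m - n)) \<in> square_summable" "l2norm (\<lambda>m. a (m - n)) = l2norm a"
proof -
  have bij: "bij_betw (\<lambda>m. m - n) UNIV (UNIV :: int set)"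
    by (rule bij_betwI[where g = "\<lambda>m. m + n"]) auto
  show "(\<lambda>m. a (m - n)) \<in> square_summable"
    using assms summable_on_reindex_bij_betw[OF bij, of "\<lambda>j. (cmod (a j))\<^sup>2"]
    by (simp add: square_summable_def)
  show "l2norm (\<lambda>m. a (m - n)) = l2norm a"
    using infsum_reindex_bij_betw[OF bij, of "\<lambda>j. (cmod (a j))\<^sup>2"] by (simp add: l2norm_def)
qed

text \<open>
  The terms of the sum defining a coordinate of the convolution are dominated by
  $w_{m-n}^2 + |a_n|^2$, so the sum converges absolutely.
\<close>

lemma conv_summable:
  assumes w: "(\<lambda>j. (w j)\<^sup>2) summable_on UNIV" and a: "a \<in> square_summable"
  shows "(\<lambda>n. of_real (w (m - n)) * a n) summable_on UNIV"
proof (rule Infinite_Sum.abs_summable_summable, rule Infinite_Sum.abs_summable_on_comparison_test')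
  have "bij_betw (\<lambda>n. m - n) UNIV (UNIV :: int set)"
    by (rule bij_betwI[where g = "\<lambda>n. m - n"]) auto
  from summable_on_reindex_bij_betw[OF this, of "\<lambda>j. (w j)\<^sup>2"] w
  have "(\<lambda>n. (w (m - n))\<^sup>2) summable_on UNIV" by simp
  then show "(\<lambda>n. (w (m - n))\<^sup>2 + (cmod (a n))\<^sup>2) summable_on UNIV"
    using a by (intro summable_on_add) (auto simp: square_summable_def)
  fix n
  show "norm (of_real (w (m - n)) * a n) \<le> (w (m - n))\<^sup>2 + (cmod (a n))\<^sup>2"
    using abs_mult_le_sum_squares[of "w (m - n)" "cmod (a n)"] by (simp add: norm_mult abs_mult)
qed

lemma L2_set_sum_le:
  fixes f :: "'a \<Rightarrow> 'b \<Rightarrow> complex"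
  shows "L2_set (\<lambda>m. cmod (\<Sum>n\<in>A. f n m)) F \<le> (\<Sum>n\<in>A. L2_set (\<lambda>m. cmod (f n m)) F)"
proof (induction A rule: infinite_finite_induct)
  case (insert x A)
  have "L2_set (\<lambda>m. cmod (\<Sum>n\<in>insert x A. f n m)) F
      \<le> L2_set (\<lambda>m. cmod (f x m) + cmod (\<Sum>n\<in>A. f n m)) F"
    using insert by (intro L2_set_mono) (auto intro: norm_triangle_ineq)
  also have "\<dots> \<le> L2_set (\<lambda>m. cmod (f x m)) F + L2_set (\<lambda>m. cmod (\<Sum>n\<in>A. f n m)) F"
    by (rule L2_set_triangle_ineq)
  finally show ?case using insert by simp
qed (auto simp: L2_set_def)

text \<open>
  Young's inequality for $\ell^1 * \ell^2$: the convolution is the sum over \<open>n\<close> of the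
  translates of \<open>a\<close> by \<open>n\<close>, weighted by \<open>w n\<close>, and translation preserves the norm.
\<close>

lemma conv_Young:
  assumes w: "(\<lambda>j. \<bar>w j\<bar>) summable_on UNIV" and a: "a \<in> square_summable"
  shows "(\<lambda>j. (w j)\<^sup>2) summable_on UNIV"
    and "conv w a \<in> square_summable" and "l2norm (conv w a) \<le> (\<Sum>\<^sub>\<infinity>j. \<bar>w j\<bar>) * l2norm a"
proof -
  have le: "(\<Sum>j\<in>A. \<bar>w j\<bar>) \<le> (\<Sum>\<^sub>\<infinity>j. \<bar>w j\<bar>)" if "finite A" for A
    using that w by (intro finite_sum_le_infsum) auto
  have "(\<lambda>j. (\<Sum>\<^sub>\<infinity>j. \<bar>w j\<bar>) * \<bar>w j\<bar>) summable_on UNIV"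
    by (intro summable_on_cmult_right w)
  then show sq: "(\<lambda>j. (w j)\<^sup>2) summable_on UNIV"
  proof (rule summable_on_comparison_test)
    fix j
    show "(w j)\<^sup>2 \<le> (\<Sum>\<^sub>\<infinity>j. \<bar>w j\<bar>) * \<bar>w j\<bar>"
      using mult_right_mono[OF le[of "{j}"], of "\<bar>w j\<bar>"] by (simp add: power2_eq_square)
  qed auto
  have bij: "bij_betw (\<lambda>n. m - n) UNIV (UNIV :: int set)" for m
    by (rule bij_betwI[where g = "\<lambda>n. m - n"]) auto
  have conv: "conv w a = (\<lambda>m. \<Sum>\<^sub>\<infinity>n. of_real (w n) * a (m - n))"
  proof
    fix m show "conv w a m = (\<Sum>\<^sub>\<infinity>n. of_real (w n) * a (m - n))"
      using infsum_reindex_bij_betw[OF bij[of m], of "\<lambda>n. of_real (w (m - n)) * a n"]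
      by (simp add: conv_def)
  qed
  have "(\<lambda>n. of_real (w n) * a (m - n)) summable_on UNIV" for m
    using summable_on_reindex_bij_betw[OF bij[of m], of "\<lambda>n. of_real (w (m - n)) * a n"]
      conv_summable[OF sq a, of m] by simp
  moreover have "L2_set (\<lambda>m. cmod (\<Sum>n\<in>A. of_real (w n) * a (m - n))) F \<le> (\<Sum>\<^sub>\<infinity>j. \<bar>w j\<bar>) * l2norm a"
    if "finite A" "finite F" for A F
  proof -
    have "L2_set (\<lambda>m. cmod (\<Sum>n\<in>A. of_real (w n) * a (m - n))) F
        \<le> (\<Sum>n\<in>A. L2_set (\<lambda>m. cmod (of_real (w n) * a (m - n))) F)"
      by (rule L2_set_sum_le)
    also have "\<dots> = (\<Sum>n\<in>A. \<bar>w n\<bar> * L2_set (\<lambda>m. cmod (a (m - n))) F)"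
      by (simp add: norm_mult L2_set_right_distrib)
    also have "\<dots> \<le> (\<Sum>n\<in>A. \<bar>w n\<bar> * l2norm a)"
      using L2_set_le_l2norm[OF square_summable_shift(1)[OF a] that(2)] square_summable_shift(2)[OF a]
      by (intro sum_mono mult_left_mono) auto
    also have "\<dots> = (\<Sum>n\<in>A. \<bar>w n\<bar>) * l2norm a"
      by (simp add: sum_distrib_right)
    also have "\<dots> \<le> (\<Sum>\<^sub>\<infinity>j. \<bar>w j\<bar>) * l2norm a"
      by (intro mult_right_mono le that) (auto simp: l2norm_def intro!: infsum_nonneg)
    finally show ?thesis .
  qed
  ultimately show "conv w a \<in> square_summable" "l2norm (conv w a) \<le> (\<Sum>\<^sub>\<infinity>j. \<bar>w j\<bar>) * l2norm a"
    unfolding conv by (rule infsum_square_summable; simp)+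
qed

lemma has_sum_sum:
  fixes f :: "'a \<Rightarrow> 'b \<Rightarrow> 'c :: topological_comm_monoid_add"
  assumes "\<And>n. n \<in> A \<Longrightarrow> (f n has_sum s n) B"
  shows "((\<lambda>x. \<Sum>n\<in>A. f n x) has_sum (\<Sum>n\<in>A. s n)) B"
  using assms
proof (induction A rule: infinite_finite_induct)
  case (insert n A)
  then have "((\<lambda>x. f n x + (\<Sum>n\<in>A. f n x)) has_sum (s n + (\<Sum>n\<in>A. s n))) B"
    by (intro has_sum_add) auto
  with insert show ?case by simp
qed auto

text \<open>
  If the integer translates of \<open>w\<close> are orthonormal, then for a finite set \<open>A\<close> the combination
  of translates with coefficients \<open>a n\<close>, \<open>n \<in> A\<close>, has squared norm
  $\sum_{n \in A} |a_n|^2$; the bound for \<open>a\<close> itself follows from \<open>infsum_square_summable\<close>.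
\<close>

lemma conv_orthonormal:
  fixes w :: "int \<Rightarrow> real"
  assumes w: "\<And>k l. ((\<lambda>m. w (m - k) * w (m - l)) has_sum (if k = l then 1 else 0)) UNIV"
    and a: "a \<in> square_summable"
  shows "(\<lambda>j. (w j)\<^sup>2) summable_on UNIV"
    and "conv w a \<in> square_summable" and "l2norm (conv w a) \<le> l2norm a"
proof -
  show sq: "(\<lambda>j. (w j)\<^sup>2) summable_on UNIV"
    using w[of 0 0] by (auto simp: power2_eq_square dest: has_sum_imp_summable)
  have "L2_set (\<lambda>m. cmod (\<Sum>n\<in>A. of_real (w (m - n)) * a n)) F \<le> l2norm a"
    if A: "finite A" and F: "finite F" for A F
  proof -
    let ?h = "\<lambda>m. \<Sum>n\<in>A. of_real (w (m - n)) * a n"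
    \<comment> \<open>Expand the squared modulus into a double sum and sum over \<open>m\<close> first.\<close>
    have "((\<lambda>m. \<Sum>n\<in>A. \<Sum>l\<in>A. of_real (w (m - n) * w (m - l)) * (a n * cnj (a l))) has_sum
            (\<Sum>n\<in>A. \<Sum>l\<in>A. of_real (if n = l then 1 else 0) * (a n * cnj (a l)))) UNIV"
      by (intro has_sum_sum has_sum_cmult_left has_sum_of_real w)
    also have "(\<lambda>m. \<Sum>n\<in>A. \<Sum>l\<in>A. of_real (w (m - n) * w (m - l)) * (a n * cnj (a l)))
        = (\<lambda>m. complex_of_real ((cmod (?h m))\<^sup>2))"
      by (simp only: complex_norm_square cnj_sum sum_product complex_cnj_mult complex_cnj_complex_of_real
            of_real_mult mult_ac)
    also have "(\<Sum>n\<in>A. \<Sum>l\<in>A. of_real (if n = l then 1 else 0) * (a n * cnj (a l)))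
        = complex_of_real (\<Sum>n\<in>A. (cmod (a n))\<^sup>2)"
    proof -
      have "(\<Sum>l\<in>A. of_real (if n = l then 1 else 0) * (a n * cnj (a l)))
          = complex_of_real ((cmod (a n))\<^sup>2)" if "n \<in> A" for n
      proof -
        have "(\<Sum>l\<in>A. of_real (if n = l then 1 else 0) * (a n * cnj (a l)))
            = (\<Sum>l\<in>A. if l = n then a n * cnj (a n) else 0)"
          by (intro sum.cong) auto
        then show ?thesis using A that by (simp add: complex_norm_square del: of_real_power)
      qed
      then show ?thesis by simp
    qed
    finally have "((\<lambda>m. (cmod (?h m))\<^sup>2) has_sum (\<Sum>n\<in>A. (cmod (a n))\<^sup>2)) UNIV"
      by (simp only: has_sum_of_real_iff)
    then have "(\<Sum>m\<in>F. (cmod (?h m))\<^sup>2) \<le> (\<Sum>n\<in>A. (cmod (a n))\<^sup>2)"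
      by (rule finite_sum_le_has_sum) (use F in auto)
    then have "L2_set (\<lambda>m. cmod (?h m)) F \<le> L2_set (\<lambda>n. cmod (a n)) A"
      unfolding L2_set_def by (rule real_sqrt_le_mono)
    also have "\<dots> \<le> l2norm a"
      by (rule L2_set_le_l2norm[OF a A])
    finally show ?thesis .
  qed
  note bound = this
  show "conv w a \<in> square_summable" "l2norm (conv w a) \<le> l2norm a"
    unfolding conv_def by (rule infsum_square_summable conv_summable[OF sq a] bound; assumption?)+
qed

section \<open>Convolutions as operators on the space of square-summable sequences\<close>

lemma seq_of_ell2_op:
  "(\<And>a. a \<in> square_summable \<Longrightarrow> F a \<in> square_summable) \<Longrightarrow> seq_of (ell2_op F x) = F (seq_of x)"
  unfolding ell2_op_def by (intro ell2_of_inverse) (use seq_of in auto)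

lemma seq_of_eqI: "(\<And>j. seq_of x j = seq_of y j) \<Longrightarrow> x = y"
  by (simp add: seq_of_inject[symmetric] ext)

lemma conv_add:
  assumes "(\<lambda>j. (w j)\<^sup>2) summable_on UNIV" "a \<in> square_summable" "b \<in> square_summable"
  shows "conv w (\<lambda>j. a j + b j) m = conv w a m + conv w b m"
  using infsum_add[OF conv_summable[OF assms(1,2)] conv_summable[OF assms(1,3)], of m m]
  by (simp add: conv_def algebra_simps)

lemma conv_scale: "conv w (\<lambda>j. c * a j) m = c * conv w a m"
  using infsum_cmult_right'[of c "\<lambda>n. of_real (w (m - n)) * a n" UNIV]
  by (simp add: conv_def algebra_simps)

lemma conv_bounded_clinear:
  assumes w: "(\<lambda>j. (w j)\<^sup>2) summable_on UNIV"
    and sq: "\<And>a. a \<in> square_summable \<Longrightarrow> conv w a \<in> square_summable"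
    and le: "\<And>a. a \<in> square_summable \<Longrightarrow> l2norm (conv w a) \<le> C * l2norm a"
  shows "bounded_clinear (ell2_op (conv w))"
proof -
  have seq: "seq_of (ell2_op (conv w) x) = conv w (seq_of x)" for x
    by (rule seq_of_ell2_op[OF sq])
  have add: "ell2_op (conv w) (x + y) = ell2_op (conv w) x + ell2_op (conv w) y" for x y
    by (rule seq_of_eqI) (simp add: seq plus_ell2.rep_eq conv_add[OF w seq_of seq_of])
  have scaleC: "ell2_op (conv w) (c *\<^sub>C x) = c *\<^sub>C ell2_op (conv w) x" for c x
    by (rule seq_of_eqI) (simp add: seq scaleC_ell2.rep_eq conv_scale)
  have "ell2_op (conv w) (r *\<^sub>R x) = r *\<^sub>R ell2_op (conv w) x" for r x
    using scaleC[of "of_real r" x] by (simp add: scaleC_of_real)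
  moreover have "norm (ell2_op (conv w) x) \<le> norm x * C" for x
    using le[OF seq_of, of x] by (simp add: norm_ell2.rep_eq seq mult.commute)
  ultimately have "bounded_linear (ell2_op (conv w))"
    using add by (intro bounded_linear_intro)
  moreover have "clinear (ell2_op (conv w))"
    by (simp add: Vector_Spaces.linear_iff vector_space_scaleC add scaleC)
  ultimately show ?thesis by (simp add: bounded_clinear_def)
qed

definition unit_vector :: "int \<Rightarrow> ell2" where
  "unit_vector n = ell2_of (\<lambda>j. if j = n then 1 else 0)"

lemma seq_of_unit_vector: "seq_of (unit_vector n) j = (if j = n then 1 else 0)"
proof -
  have "(\<lambda>j. (cmod (if j = n then 1 else 0))\<^sup>2) summable_on UNIV"
    by (subst summable_on_cong_neutral[where T = "{n}" and g = "\<lambda>_. 1"]) auto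
  then show ?thesis
    unfolding unit_vector_def by (subst ell2_of_inverse) (auto simp: square_summable_def)
qed

text \<open>
  The error of a partial sum over \<open>A\<close> has squared norm $\sum_{j \notin A} |x_j|^2$, the tail of
  a convergent series.
\<close>

lemma unit_vector_expansion: "((\<lambda>n. seq_of x n *\<^sub>C unit_vector n) has_sum x) UNIV"
proof -
  have seq_sum: "seq_of (\<Sum>n\<in>A. seq_of x n *\<^sub>C unit_vector n) j = (if j \<in> A then seq_of x j else 0)"
    if "finite A" for A j
    using that by (induction A)
      (auto simp: zero_ell2.rep_eq plus_ell2.rep_eq scaleC_ell2.rep_eq seq_of_unit_vector)
  have x: "(\<lambda>j. (cmod (seq_of x j))\<^sup>2) summable_on UNIV"
    using seq_of[of x] by (simp add: square_summable_def)
  let ?S = "\<Sum>\<^sub>\<infinity>j. (cmod (seq_of x j))\<^sup>2"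
  have norm: "norm ((\<Sum>n\<in>A. seq_of x n *\<^sub>C unit_vector n) - x) = sqrt (?S - (\<Sum>j\<in>A. (cmod (seq_of x j))\<^sup>2))"
    if A: "finite A" for A
  proof -
    have "(\<Sum>\<^sub>\<infinity>j. (cmod (if j \<in> A then seq_of x j - seq_of x j else 0 - seq_of x j))\<^sup>2)
        = (\<Sum>\<^sub>\<infinity>j\<in>UNIV - A. (cmod (seq_of x j))\<^sup>2)"
      by (rule infsum_cong_neutral) auto
    also have "\<dots> = ?S - (\<Sum>j\<in>A. (cmod (seq_of x j))\<^sup>2)"
      using infsum_Diff[OF x, of A] A by simp
    finally show ?thesis
      by (simp add: norm_ell2.rep_eq l2norm_def minus_ell2.rep_eq seq_sum[OF A] if_distrib[of "\<lambda>u. u - _"])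
  qed
  have "((\<lambda>A. sqrt (?S - (\<Sum>j\<in>A. (cmod (seq_of x j))\<^sup>2))) \<longlongrightarrow> sqrt (?S - ?S)) (finite_subsets_at_top UNIV)"
    using has_sum_infsum[OF x] unfolding has_sum_def by (intro tendsto_intros)
  then have "((\<lambda>A. sqrt (?S - (\<Sum>j\<in>A. (cmod (seq_of x j))\<^sup>2))) \<longlongrightarrow> 0) (finite_subsets_at_top UNIV)"
    by simp
  moreover have "\<forall>\<^sub>F A in finite_subsets_at_top UNIV. sqrt (?S - (\<Sum>j\<in>A. (cmod (seq_of x j))\<^sup>2))
       = norm ((\<Sum>n\<in>A. seq_of x n *\<^sub>C unit_vector n) - x)"
    by (rule eventually_finite_subsets_at_top_weakI) (simp add: norm)
  ultimately have "((\<lambda>A. norm ((\<Sum>n\<in>A. seq_of x n *\<^sub>C unit_vector n) - x)) \<longlongrightarrow> 0) (finite_subsets_at_top UNIV)"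
    by (rule Lim_transform_eventually)
  then show ?thesis
    unfolding has_sum_def by (simp add: tendsto_norm_zero_iff LIM_zero_iff)
qed

text \<open>
  The unit vectors span a dense subspace.
\<close>

lemma bounded_clinear_eqI:
  fixes f g :: "ell2 \<Rightarrow> ell2"
  assumes f: "bounded_clinear f" and g: "bounded_clinear g"
    and eq: "\<And>n. f (unit_vector n) = g (unit_vector n)"
  shows "f = g"
proof
  fix x
  have "((\<lambda>n. h (seq_of x n *\<^sub>C unit_vector n)) has_sum h x) UNIV" if "bounded_clinear h" for h :: "ell2 \<Rightarrow> ell2"
    using that unit_vector_expansion by (auto simp: bounded_clinear_def intro: has_sum_bounded_linear)
  moreover have "f (seq_of x n *\<^sub>C unit_vector n) = g (seq_of x n *\<^sub>C unit_vector n)" for n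
    using f g eq by (simp add: bounded_clinear_def linear_iff Vector_Spaces.linear_iff)
  ultimately show "f x = g x"
    using f g by (metis (no_types, lifting) has_sum_cong has_sum_unique)
qed

section \<open>The group law and isometry\<close>

text \<open>
  The convolution kernel of $T_t$. Writing it with \<^const>\<open>sinc\<close> covers integral and
  non-integral \<open>t\<close> by one formula: for integral \<open>t\<close> it is supported at \<open>- t\<close>.
\<close>

definition trans_kernel :: "real \<Rightarrow> int \<Rightarrow> real" where
  "trans_kernel t j = (- 1) powi j * sinc (t + of_int j)"

lemma minus_one_powi_split: "(- 1 :: real) powi (m - n) * (- 1) powi n = (- 1) powi m"
  by (simp add: power_int_minus_left)

text \<open>
  This is the group law at the level of kernels; the signs combine to $(-1)^m$, and the addition formula
  of the cardinal sine does the rest.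
\<close>

lemma trans_kernel_conv:
  "((\<lambda>n. trans_kernel s (m - n) * trans_kernel t n) has_sum trans_kernel (s + t) m) UNIV"
proof -
  have "((\<lambda>n. (- 1) powi m * (sinc ((s + of_int m) - of_int n) * sinc (t + of_int n)))
      has_sum (- 1) powi m * sinc ((s + of_int m) + t)) UNIV"
    by (intro has_sum_cmult_right sinc_convolution)
  moreover have "(- 1) powi m * (sinc ((s + of_int m) - of_int n) * sinc (t + of_int n))
      = trans_kernel s (m - n) * trans_kernel t n" for n
    unfolding trans_kernel_def minus_one_powi_split[of m n, symmetric] by (simp add: algebra_simps)
  ultimately show ?thesis by (simp add: trans_kernel_def add_ac)
qed

lemma trans_kernel_minus: "trans_kernel (- t) j = trans_kernel t (- j)"
  using sinc_minus[of "t - of_int j"] by (simp add: trans_kernel_def power_int_minus_one_minus)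

lemma trans_kernel_0: "trans_kernel 0 j = (if j = 0 then 1 else 0)"
  by (simp add: trans_kernel_def sinc_of_int)

text \<open>
  The kernel of $T_{-t}$ is the reflection of that of $T_t$, so the inner product of two
  translates is a value of $k_{-t} * k_t = k_0$.
\<close>

lemma trans_kernel_orthonormal:
  "((\<lambda>m. trans_kernel t (m - k) * trans_kernel t (m - l)) has_sum (if k = l then 1 else 0)) UNIV"
proof -
  have "((\<lambda>n. trans_kernel (- t) ((k - l) - n) * trans_kernel t n) has_sum (if k = l then 1 else 0)) UNIV"
    using trans_kernel_conv[of "- t" "k - l" t] by (simp add: trans_kernel_0)
  moreover have "bij_betw (\<lambda>m. m - l) UNIV (UNIV :: int set)"
    by (rule bij_betwI[where g = "\<lambda>m. m + l"]) auto
  ultimately show ?thesis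
    using has_sum_reindex_bij_betw[of "\<lambda>m. m - l" UNIV UNIV
        "\<lambda>n. trans_kernel (- t) ((k - l) - n) * trans_kernel t n"]
    by (simp add: trans_kernel_minus)
qed

lemma trans_kernel_notin_Ints:
  assumes "t \<notin> \<int>"
  shows "trans_kernel t j = sin (pi * t) / (pi * (of_int j + t))"
proof -
  have "t + of_int j \<noteq> 0"
    using assms by (auto simp: add_eq_0_iff2)
  then show ?thesis
    by (simp add: trans_kernel_def sinc_def sin_pi_add_int power_int_minus_left add.commute)
qed

lemma T_map_eq_conv: "T_map t = conv (trans_kernel t)"
proof (intro ext)
  fix a m
  show "T_map t a m = conv (trans_kernel t) a m"
  proof (cases "t \<in> \<int>")
    case True
    then obtain k where t: "t = of_int k" by (auto elim: Ints_cases)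
    have sinc: "sinc (of_int k + of_int j) = (if j = - k then 1 else 0)" for j
      using sinc_of_int[of "k + j"] by auto
    have "conv (trans_kernel t) a m = (\<Sum>\<^sub>\<infinity>n\<in>{m + k}. of_real ((- 1) powi k) * a n)"
      unfolding conv_def t trans_kernel_def sinc
      by (rule infsum_cong_neutral) (auto simp: power_int_minus_one_minus)
    also have "\<dots> = T_map t a m"
      by (simp add: T_map_def t)
    finally show ?thesis by simp
  next
    case False
    have "of_real (sin (pi * t) / pi) * (a n / of_real (of_int m - of_int n + t))
        = of_real (trans_kernel t (m - n)) * a n" for n
      by (simp add: trans_kernel_notin_Ints[OF False])
    then show ?thesis
      using False infsum_cmult_right'[of "of_real (sin (pi * t) / pi)"
          "\<lambda>n. a n / of_real (of_int m - of_int n + t)" UNIV]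
      by (simp add: T_map_def conv_def)
  qed
qed

lemma T_map_square_summable: "a \<in> square_summable \<Longrightarrow> T_map t a \<in> square_summable"
  unfolding T_map_eq_conv by (rule conv_orthonormal(2)[OF trans_kernel_orthonormal])

lemma seq_of_T_op: "seq_of (T_op t x) = conv (trans_kernel t) (seq_of x)"
  unfolding T_op_def using seq_of_ell2_op[OF T_map_square_summable] by (simp add: T_map_eq_conv)

lemma T_op_bounded_clinear: "bounded_clinear (T_op t)"
  unfolding T_op_def T_map_eq_conv
  by (rule conv_bounded_clinear[where C = 1])
    (use conv_orthonormal[OF trans_kernel_orthonormal] square_summable_zero in auto)

lemma norm_T_op_le: "norm (T_op t x) \<le> norm x"
  using conv_orthonormal(3)[OF trans_kernel_orthonormal seq_of, of t x]
  by (simp add: norm_ell2.rep_eq seq_of_T_op)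

text \<open>
  Unit vectors are mapped to translates of the kernel, so the group law on them is the
  convolution identity for kernels.
\<close>

lemma T_op_unit_vector: "seq_of (T_op t (unit_vector n)) m = trans_kernel t (m - n)"
proof -
  have "conv (trans_kernel t) (seq_of (unit_vector n)) m
      = (\<Sum>\<^sub>\<infinity>j\<in>{n}. complex_of_real (trans_kernel t (m - j)))"
    unfolding conv_def by (rule infsum_cong_neutral) (auto simp: seq_of_unit_vector)
  then show ?thesis by (simp add: seq_of_T_op)
qed

lemma bounded_clinear_compose:
  "bounded_clinear f \<Longrightarrow> bounded_clinear g \<Longrightarrow> bounded_clinear (f \<circ> g)"
  using bounded_linear_compose[of f g]
  by (auto simp: bounded_clinear_def o_def Vector_Spaces.linear_iff)

lemma T_op_0: "T_op 0 = id"
proof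
  fix x
  have "conv (trans_kernel 0) (seq_of x) m = (\<Sum>\<^sub>\<infinity>n\<in>{m}. seq_of x n)" for m
    unfolding conv_def trans_kernel_0 by (rule infsum_cong_neutral) auto
  then show "T_op 0 x = id x"
    by (intro seq_of_eqI) (simp add: seq_of_T_op)
qed

lemma T_op_add: "T_op s \<circ> T_op t = T_op (s + t)"
proof (rule bounded_clinear_eqI)
  fix n
  show "(T_op s \<circ> T_op t) (unit_vector n) = T_op (s + t) (unit_vector n)"
  proof (rule seq_of_eqI)
    fix m
    have "((\<lambda>j. trans_kernel s ((m - n) - j) * trans_kernel t j) has_sum trans_kernel (s + t) (m - n)) UNIV"
      by (rule trans_kernel_conv)
    moreover have "bij_betw (\<lambda>j. j - n) UNIV (UNIV :: int set)"
      by (rule bij_betwI[where g = "\<lambda>m. m + n"]) auto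
    ultimately have "((\<lambda>j. trans_kernel s (m - j) * trans_kernel t (j - n)) has_sum trans_kernel (s + t) (m - n)) UNIV"
      using has_sum_reindex_bij_betw[of "\<lambda>j. j - n" UNIV UNIV
        "\<lambda>j. trans_kernel s ((m - n) - j) * trans_kernel t j"] by simp
    from has_sum_of_real[OF this, where 'a = complex]
    show "seq_of ((T_op s \<circ> T_op t) (unit_vector n)) m = seq_of (T_op (s + t) (unit_vector n)) m"
      by (simp add: seq_of_T_op[of s] T_op_unit_vector conv_def infsumI)
  qed
qed (intro bounded_clinear_compose T_op_bounded_clinear)+

text \<open>
  Both $T_t$ and its inverse $T_{-t}$ are contractions.
\<close>

lemma norm_T_op: "norm (T_op t x) = norm x"
proof (rule antisym)
  have "x = T_op (- t) (T_op t x)"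
    using T_op_add[of "- t" t] T_op_0 by (metis add.left_inverse comp_apply id_apply)
  then show "norm x \<le> norm (T_op t x)"
    using norm_T_op_le[of "- t" "T_op t x"] by simp
qed (rule norm_T_op_le)

section \<open>The Hilbert transform as derivative at zero\<close>

text \<open>
  Division by zero makes the kernel vanish at \<open>j = 0\<close>, as the excluded diagonal term requires.
\<close>

definition hilbert_kernel :: "int \<Rightarrow> real" where
  "hilbert_kernel j = 1 / (pi * of_int j)"

text \<open>
  Off the diagonal, what must be added to $1/j$ to obtain the shifted kernel $1/(j+h)$.
\<close>

definition error_kernel :: "real \<Rightarrow> int \<Rightarrow> real" where
  "error_kernel h j = (if j = 0 then 0 else 1 / (of_int j + h) - 1 / of_int j)"

lemma H_map_eq_conv: "H_map = conv hilbert_kernel"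
proof (intro ext)
  fix a m
  have "conv hilbert_kernel a m = (\<Sum>\<^sub>\<infinity>n\<in>{n. n \<noteq> m}. of_real (1 / pi) * (a n / of_int (m - n)))"
    unfolding conv_def by (rule infsum_cong_neutral) (auto simp: hilbert_kernel_def)
  then show "H_map a m = conv hilbert_kernel a m"
    by (simp only: H_map_def infsum_cmult_right')
qed

text \<open>
  The sequence $1/(1/2 + j)^2$, whose sum is at hand, serves as the summable majorant for $1/j^2$; it has
  the advantage of being defined also at $j = 0$.
\<close>

lemma bilateral_half_integer_sum: "((\<lambda>j::int. 1 / (1 / 2 + of_int j)\<^sup>2) has_sum pi\<^sup>2) UNIV"
proof -
  have "(1 / 2 :: real) \<notin> \<int>"
    using fraction_not_in_Ints[of 2 1, where 'a = real] by simp
  from inverse_square_bilateral_sum[OF this] show ?thesis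
    by simp
qed

lemma half_integer_le: "j \<noteq> 0 \<Longrightarrow> \<bar>1 / 2 + of_int j\<bar> \<le> 2 * \<bar>of_int j :: real\<bar>"
proof -
  assume "j \<noteq> 0"
  then have "1 \<le> \<bar>of_int j :: real\<bar>" by linarith
  then show ?thesis by linarith
qed

lemma error_kernel_le:
  assumes "\<bar>h\<bar> \<le> 1 / 2"
  shows "\<bar>error_kernel h j\<bar> \<le> 8 * \<bar>h\<bar> * (1 / (1 / 2 + of_int j)\<^sup>2)"
proof (cases "j = 0")
  case False
  then have j: "1 \<le> \<bar>of_int j :: real\<bar>" by linarith
  have jh: "\<bar>of_int j :: real\<bar> / 2 \<le> \<bar>of_int j + h\<bar>"
    using j assms by linarith
  have nz: "of_int j + h \<noteq> 0" "of_int j \<noteq> (0 :: real)"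
    using j jh by auto
  have half: "0 < \<bar>1 / 2 + of_int j :: real\<bar>"
    using j by linarith
  have "error_kernel h j = - h / (of_int j * (of_int j + h))"
    using False nz by (simp add: error_kernel_def divide_simps)
  then have "\<bar>error_kernel h j\<bar> = \<bar>h\<bar> / (\<bar>of_int j\<bar> * \<bar>of_int j + h\<bar>)"
    by (simp add: abs_mult)
  \<comment> \<open>Both factors are bounded below: $|j| \ge |1/2 + j|/2$ and $|j + h| \ge |j|/2 \ge |1/2 + j|/4$.\<close>
  also have "\<dots> \<le> \<bar>h\<bar> / (\<bar>1 / 2 + of_int j\<bar> / 2 * (\<bar>1 / 2 + of_int j\<bar> / 4))"
    using half_integer_le[OF False] j jh half
    by (intro divide_left_mono mult_mono mult_pos_pos) auto
  also have "\<dots> = 8 * \<bar>h\<bar> * (1 / (1 / 2 + of_int j)\<^sup>2)"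
  proof -
    have "b / (u / 2 * (u / 4)) = 8 * b * (1 / u\<^sup>2)" for b u :: real
      by (simp add: power2_eq_square)
    from this[of "\<bar>h\<bar>" "\<bar>1 / 2 + of_int j\<bar>"] show ?thesis
      by (simp only: power2_abs)
  qed
  finally show ?thesis .
qed (simp add: error_kernel_def)

lemma error_kernel_sum:
  assumes "\<bar>h\<bar> \<le> 1 / 2"
  shows "(\<lambda>j. \<bar>error_kernel h j\<bar>) summable_on UNIV"
    and "(\<Sum>\<^sub>\<infinity>j. \<bar>error_kernel h j\<bar>) \<le> 8 * \<bar>h\<bar> * pi\<^sup>2"
proof -
  have B: "((\<lambda>j::int. 8 * \<bar>h\<bar> * (1 / (1 / 2 + of_int j)\<^sup>2)) has_sum 8 * \<bar>h\<bar> * pi\<^sup>2) UNIV"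
    by (intro has_sum_cmult_right bilateral_half_integer_sum)
  show s: "(\<lambda>j. \<bar>error_kernel h j\<bar>) summable_on UNIV"
    by (rule summable_on_comparison_test[OF has_sum_imp_summable[OF B]])
      (use error_kernel_le[OF assms] in auto)
  show "(\<Sum>\<^sub>\<infinity>j. \<bar>error_kernel h j\<bar>) \<le> 8 * \<bar>h\<bar> * pi\<^sup>2"
    by (rule has_sum_mono[OF has_sum_infsum[OF s] B]) (rule error_kernel_le[OF assms])
qed

lemma hilbert_kernel_square_summable: "(\<lambda>j. (hilbert_kernel j)\<^sup>2) summable_on UNIV"
proof (rule summable_on_comparison_test)
  show "(\<lambda>j::int. 4 / pi\<^sup>2 * (1 / (1 / 2 + of_int j)\<^sup>2)) summable_on UNIV"
    by (intro summable_on_cmult_right has_sum_imp_summable[OF bilateral_half_integer_sum])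
  fix j :: int
  show "(hilbert_kernel j)\<^sup>2 \<le> 4 / pi\<^sup>2 * (1 / (1 / 2 + of_int j)\<^sup>2)"
  proof (cases "j = 0")
    case False
    have "0 < \<bar>1 / 2 + of_int j :: real\<bar>"
      using False by linarith
    moreover have "(1 / 2 + of_int j :: real)\<^sup>2 \<le> (2 * of_int j)\<^sup>2"
      using half_integer_le[OF False] by (intro abs_le_square_iff[THEN iffD1]) (simp add: abs_mult)
    ultimately have "1 / (2 * of_int j)\<^sup>2 \<le> (1 / (1 / 2 + of_int j :: real)\<^sup>2)"
      by (intro divide_left_mono mult_pos_pos) (use False in auto)
    then have "4 / pi\<^sup>2 * (1 / (2 * of_int j)\<^sup>2) \<le> 4 / pi\<^sup>2 * (1 / (1 / 2 + of_int j :: real)\<^sup>2)"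
      by (intro mult_left_mono) auto
    then show ?thesis
      by (simp add: hilbert_kernel_def power_mult_distrib power_divide)
  qed (simp add: hilbert_kernel_def)
qed auto

text \<open>
  Off the diagonal the kernel is $\frac{\sin(\pi h)}{\pi}\cdot\frac{1}{j+h}$, and the error kernel replaces
  $1/(j+h)$ by $1/j$; the diagonal entry $\mathrm{sinc}(h)$ accounts for the last term.
\<close>

lemma trans_kernel_decomp:
  assumes "0 < \<bar>h\<bar>" "\<bar>h\<bar> \<le> 1 / 2"
  shows "trans_kernel h j =
    sin (pi * h) * hilbert_kernel j + sin (pi * h) / pi * error_kernel h j + sinc h * (if j = 0 then 1 else 0)"
proof -
  have h: "h \<notin> \<int>"
    using assms by (auto elim!: Ints_cases)
  show ?thesis
    by (cases "j = 0")
      (use assms in \<open>simp_all add: trans_kernel_notin_Ints[OF h] hilbert_kernel_def error_kernel_def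
        sinc_def right_diff_distrib\<close>)
qed

lemma conv_trans_kernel_decomp:
  assumes h: "0 < \<bar>h\<bar>" "\<bar>h\<bar> \<le> 1 / 2" and a: "a \<in> square_summable"
  shows "conv (trans_kernel h) a m = of_real (sin (pi * h)) * conv hilbert_kernel a m
    + of_real (sin (pi * h) / pi) * conv (error_kernel h) a m + of_real (sinc h) * a m"
proof -
  have H: "((\<lambda>n. of_real (sin (pi * h)) * (of_real (hilbert_kernel (m - n)) * a n)) has_sum
      of_real (sin (pi * h)) * conv hilbert_kernel a m) UNIV"
    unfolding conv_def
    by (intro has_sum_cmult_right has_sum_infsum conv_summable hilbert_kernel_square_summable a)
  have E: "((\<lambda>n. of_real (sin (pi * h) / pi) * (of_real (error_kernel h (m - n)) * a n)) has_sum
      of_real (sin (pi * h) / pi) * conv (error_kernel h) a m) UNIV"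
    unfolding conv_def
    by (intro has_sum_cmult_right has_sum_infsum conv_summable[OF _ a] conv_Young(1)[OF _ a]
        error_kernel_sum h)
  have "((\<lambda>n. if m - n = 0 then of_real (sinc h) * a n else 0) has_sum of_real (sinc h) * a m) UNIV"
    by (rule has_sum_finite_neutralI[where B = "{m}"]) auto
  from has_sum_add[OF has_sum_add[OF H E] this]
  have "((\<lambda>n. of_real (trans_kernel h (m - n)) * a n) has_sum
      of_real (sin (pi * h)) * conv hilbert_kernel a m
      + of_real (sin (pi * h) / pi) * conv (error_kernel h) a m + of_real (sinc h) * a m) UNIV"
  proof (rule has_sum_cong[THEN iffD1, rotated])
    fix n
    show "of_real (sin (pi * h)) * (of_real (hilbert_kernel (m - n)) * a n)
        + of_real (sin (pi * h) / pi) * (of_real (error_kernel h (m - n)) * a n)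
        + (if m - n = 0 then of_real (sinc h) * a n else 0) = of_real (trans_kernel h (m - n)) * a n"
      unfolding trans_kernel_decomp[OF h] by (cases "m - n = 0") (simp_all add: distrib_right)
  qed
  then show ?thesis
    unfolding conv_def[of "trans_kernel h"] by (rule infsumI)
qed

text \<open>
  At $h = 1/2$ the decomposition of $T_h$ can be solved for $H$, because $\sin(\pi/2) = 1$; the
  other two operators in it are bounded.
\<close>

lemma H_map_square_summable:
  assumes a: "a \<in> square_summable"
  shows "H_map a \<in> square_summable"
proof -
  let ?T = "conv (trans_kernel (1 / 2)) a" and ?E = "conv (error_kernel (1 / 2)) a"
  have "?T \<in> square_summable"
    using T_map_square_summable[OF a] by (simp add: T_map_eq_conv)
  moreover have "?E \<in> square_summable"
    by (intro conv_Young(2) error_kernel_sum a) simp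
  ultimately have "(\<lambda>m. (?T m + of_real (- 1 / pi) * ?E m) + of_real (- sinc (1 / 2)) * a m) \<in> square_summable"
    by (intro square_summable_add square_summable_scale a)
  also have "(\<lambda>m. (?T m + of_real (- 1 / pi) * ?E m) + of_real (- sinc (1 / 2)) * a m) = H_map a"
    using conv_trans_kernel_decomp[of "1 / 2", OF _ _ a] by (intro ext) (simp add: H_map_eq_conv)
  finally show ?thesis .
qed

lemma seq_of_H_op: "seq_of (H_op x) = conv hilbert_kernel (seq_of x)"
  unfolding H_op_def using seq_of_ell2_op[OF H_map_square_summable] by (simp add: H_map_eq_conv)

text \<open>
  The vector \<open>e\<close> is the convolution of \<open>x\<close> with the error kernel; later only its
  norm matters.
\<close>

lemma T_op_decomp:
  assumes h: "0 < \<bar>h\<bar>" "\<bar>h\<bar> \<le> 1 / 2"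
  shows "\<exists>e. norm e \<le> 8 * \<bar>h\<bar> * pi\<^sup>2 * norm x \<and>
    T_op h x = sin (pi * h) *\<^sub>R H_op x + (sin (pi * h) / pi) *\<^sub>R e + sinc h *\<^sub>R x"
proof (intro exI conjI)
  let ?e = "ell2_op (conv (error_kernel h)) x"
  have seq: "seq_of ?e = conv (error_kernel h) (seq_of x)"
    by (rule seq_of_ell2_op) (intro conv_Young(2) error_kernel_sum h)
  have "norm ?e \<le> (\<Sum>\<^sub>\<infinity>j. \<bar>error_kernel h j\<bar>) * norm x"
    using conv_Young(3)[OF error_kernel_sum(1)[OF h(2)] seq_of] by (simp add: norm_ell2.rep_eq seq)
  also have "\<dots> \<le> 8 * \<bar>h\<bar> * pi\<^sup>2 * norm x"
    by (intro mult_right_mono error_kernel_sum h) simp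
  finally show "norm ?e \<le> 8 * \<bar>h\<bar> * pi\<^sup>2 * norm x" .
  show "T_op h x = sin (pi * h) *\<^sub>R H_op x + (sin (pi * h) / pi) *\<^sub>R ?e + sinc h *\<^sub>R x"
    by (rule seq_of_eqI)
      (simp add: plus_ell2.rep_eq scaleR_ell2.rep_eq seq seq_of_T_op seq_of_H_op
        conv_trans_kernel_decomp[OF h seq_of])
qed

text \<open>
  The limit is taken from both sides so that it also yields continuity at 0. After dividing $T_h x - x$ by \<open>h\<close>
  and subtracting $\pi H x$, each of the three remaining terms has a coefficient or a norm tending to 0.
\<close>

theorem T_op_derivative:
  "((\<lambda>h. (T_op h x - x) /\<^sub>R h) \<longlongrightarrow> pi *\<^sub>R H_op x) (at 0)"
proof -
  define B where "B h = \<bar>sin (pi * h) / h - pi\<bar> * norm (H_op x)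
      + \<bar>sin (pi * h) / pi\<bar> * (8 * pi\<^sup>2 * norm x) + \<bar>(sin (pi * h) / (pi * h) - 1) / h\<bar> * norm x" for h
  have bound: "norm ((T_op h x - x) /\<^sub>R h - pi *\<^sub>R H_op x) \<le> B h" if h: "0 < \<bar>h\<bar>" "\<bar>h\<bar> \<le> 1 / 2" for h
  proof -
    obtain e where e: "norm e \<le> 8 * \<bar>h\<bar> * pi\<^sup>2 * norm x"
      and T: "T_op h x = sin (pi * h) *\<^sub>R H_op x + (sin (pi * h) / pi) *\<^sub>R e + sinc h *\<^sub>R x"
      using T_op_decomp[OF h] by blast
    have "(T_op h x - x) /\<^sub>R h - pi *\<^sub>R H_op x
        = (sin (pi * h) / h - pi) *\<^sub>R H_op x + (sin (pi * h) / pi / h) *\<^sub>R e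
          + ((sin (pi * h) / (pi * h) - 1) / h) *\<^sub>R x"
    proof -
      have "(s *\<^sub>R u + (s / pi) *\<^sub>R e + c *\<^sub>R x - x) /\<^sub>R h - pi *\<^sub>R u
          = (s / h - pi) *\<^sub>R u + (s / pi / h) *\<^sub>R e + ((c - 1) / h) *\<^sub>R x" for s c u
        by (simp add: algebra_simps divide_inverse)
      from this[of "sin (pi * h)" "H_op x" "sinc h"] show ?thesis
        using h by (simp only: T) (simp add: sinc_def)
    qed
    also have "norm \<dots> \<le> \<bar>sin (pi * h) / h - pi\<bar> * norm (H_op x)
        + \<bar>sin (pi * h) / pi / h\<bar> * norm e + \<bar>(sin (pi * h) / (pi * h) - 1) / h\<bar> * norm x"
      by (intro norm_triangle_mono order_refl) simp_all
    also have "\<bar>sin (pi * h) / pi / h\<bar> * norm e \<le> \<bar>sin (pi * h) / pi\<bar> * (8 * pi\<^sup>2 * norm x)"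
    proof -
      have "\<bar>sin (pi * h) / pi / h\<bar> * norm e \<le> \<bar>sin (pi * h) / pi / h\<bar> * (8 * \<bar>h\<bar> * pi\<^sup>2 * norm x)"
        by (intro mult_left_mono e) simp
      also have "\<dots> = \<bar>sin (pi * h) / pi\<bar> * (8 * pi\<^sup>2 * norm x)"
        using h by (simp add: abs_mult)
      finally show ?thesis .
    qed
    finally show ?thesis by (simp add: B_def)
  qed
  have "((\<lambda>h. sin (pi * h) / h - pi) \<longlongrightarrow> 0) (at 0)" "((\<lambda>h. sin (pi * h) / pi) \<longlongrightarrow> 0) (at 0)"
    "((\<lambda>h. (sin (pi * h) / (pi * h) - 1) / h) \<longlongrightarrow> 0) (at 0)"
    by real_asymp+
  then have "(B \<longlongrightarrow> 0 * norm (H_op x) + 0 * (8 * pi\<^sup>2 * norm x) + 0 * norm x) (at 0)"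
    unfolding B_def by (intro tendsto_intros tendsto_rabs_zero)
  then have B: "(B \<longlongrightarrow> 0) (at 0)" by simp
  have "\<forall>\<^sub>F h in at (0 :: real). 0 < \<bar>h\<bar> \<and> \<bar>h\<bar> \<le> 1 / 2"
    unfolding eventually_at by (rule exI[of _ "1 / 2"]) (auto simp: dist_real_def)
  then have "\<forall>\<^sub>F h in at 0. norm ((T_op h x - x) /\<^sub>R h - pi *\<^sub>R H_op x) \<le> B h"
    by eventually_elim (use bound in blast)
  then have "((\<lambda>h. (T_op h x - x) /\<^sub>R h - pi *\<^sub>R H_op x) \<longlongrightarrow> 0) (at 0)"
    by (rule Lim_null_comparison[OF _ B])
  then show ?thesis by (rule LIM_zero_cancel)
qed

lemma T_op_continuous_at_0: "((\<lambda>h. T_op h x) \<longlongrightarrow> x) (at 0)"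
proof -
  \<comment> \<open>A differentiable function is continuous.\<close>
  have "((\<lambda>h. h *\<^sub>R ((T_op h x - x) /\<^sub>R h) + x) \<longlongrightarrow> 0 *\<^sub>R (pi *\<^sub>R H_op x) + x) (at 0)"
    by (intro tendsto_intros T_op_derivative)
  then have "((\<lambda>h. h *\<^sub>R ((T_op h x - x) /\<^sub>R h) + x) \<longlongrightarrow> x) (at 0)" by simp
  then show ?thesis
    by (rule Lim_transform_eventually)
      (auto simp: eventually_at_filter)
qed

text \<open>
  By the group law and isometry, continuity at $t_0$ reduces to continuity at 0.
\<close>

lemma strongly_continuous_T_op: "strongly_continuous T_op"
  unfolding strongly_continuous_def
proof (intro allI)
  fix x t0
  have "norm (T_op t x - T_op t0 x) = norm (T_op (t - t0) x - x)" for t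
  proof -
    have "T_op t x = T_op t0 (T_op (t - t0) x)"
      using T_op_add[of t0 "t - t0"] by (simp add: fun_eq_iff)
    moreover have "T_op t0 (T_op (t - t0) x) - T_op t0 x = T_op t0 (T_op (t - t0) x - x)"
      using T_op_bounded_clinear[of t0] bounded_linear.linear linear_diff
      unfolding bounded_clinear_def by metis
    ultimately show ?thesis by (simp add: norm_T_op)
  qed
  moreover have "((\<lambda>h. norm (T_op h x - x)) \<longlongrightarrow> 0) (at 0)"
    using T_op_continuous_at_0[of x] by (simp add: tendsto_norm_zero_iff LIM_zero_iff)
  then have "((\<lambda>t. norm (T_op (t - t0) x - x)) \<longlongrightarrow> 0) (at t0)"
    using LIM_offset_zero_iff[of t0 "\<lambda>t. norm (T_op (t - t0) x - x)"] by simp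
  ultimately show "((\<lambda>t. norm (T_op t x - T_op t0 x)) \<longlongrightarrow> 0) (at t0)" by simp
qed

theorem theorem1p1:
  shows "(\<forall>t. \<forall>a\<in>square_summable. T_map t a \<in> square_summable) \<and>
         (\<forall>a\<in>square_summable. H_map a \<in> square_summable) \<and>
         one_parameter_group T_op \<and>
         strongly_continuous T_op \<and>
         (\<forall>t. isometry (T_op t)) \<and>
         generator_domain T_op = UNIV \<and>
         (\<forall>a. generator T_op a = complex_of_real pi *\<^sub>C H_op a)"
proof (intro conjI allI ballI)
  have lim: "((\<lambda>h. (T_op h x - x) /\<^sub>R h) \<longlongrightarrow> pi *\<^sub>R H_op x) (at_right 0)" for x
    by (rule tendsto_within_subset[OF T_op_derivative]) simp
  show "one_parameter_group T_op"
    by (simp add: one_parameter_group_def T_op_bounded_clinear T_op_0 T_op_add)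
  show "isometry (T_op t)" for t
    using T_op_bounded_clinear by (simp add: isometry_def norm_T_op bounded_clinear_def)
  show "generator_domain T_op = UNIV"
    using lim by (auto simp: generator_domain_def)
  show "generator T_op a = complex_of_real pi *\<^sub>C H_op a" for a
    using tendsto_Lim[OF trivial_limit_at_right_real lim] by (simp add: generator_def scaleC_of_real)
qed (rule T_map_square_summable H_map_square_summable strongly_continuous_T_op; assumption?)+

end
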